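(* Let $S$ be a finite $p\times q$ rectangular group over a group $G$. Then \[ \mu(S)=\min_{r\geq\mu(G)}\beta_r(p,q), \] where for $r\geq1$, $\beta_r(p,q)$ is the least $n$ such that the set $D_r(\mathcal T_n)=\{f\in\mathcal T_n:\operatorname{rank}(f)=r\}$ contains a subsemigroup isomorphic to a $p\times q$ rectangular band (with $\min\emptyset=\infty$).
   Context: $\mathcal T_n$ is the full transformation semigroup on $\{1,\dots,n\}$; the rank of a transformation is the size of its image. The degree $\mu(T)$ of a finite semigroup $T$ is the least $n\geq1$ such that $T$ embeds in $\mathcal T_n$. A $p\times q$ rectangular band is a semigroup $P\times Q$ with $|P|=p,|Q|=q$ and $(p_1,q_1)(p_2,q_2)=(p_1,q_2)$. A $p\times q$ rectangular group over $G$ is a direct product $B\times G$ with $B$ a $p\times q$ rectangular band and $G$ a group. *)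

theory Defs
  imports "HOL-Algebra.Group" "HOL-Library.Extended_Nat"
begin

text \<open>
  Semigroups are monoid records whose \<open>one\<close> field is ignored: \<open>hom\<close>, \<open>mon\<close>, \<open>iso\<close> and
  the \<open>carrier\<close> and \<open>mult\<close> fields of a direct product do not refer to it.
\<close>

definition subsemigroup :: "'a set \<Rightarrow> ('a, 'm) monoid_scheme \<Rightarrow> bool" where
  "subsemigroup H S \<longleftrightarrow>
     H \<subseteq> carrier S \<and> H \<noteq> {} \<and> (\<forall>x\<in>H. \<forall>y\<in>H. x \<otimes>\<^bsub>S\<^esub> y \<in> H)"

text \<open>
  Transformations act on the right, as is usual in semigroup theory:
  the product of \<open>f\<close> and \<open>g\<close> is first \<open>f\<close>, then \<open>g\<close>.
\<close>

definition full_transf :: "nat \<Rightarrow> (nat \<Rightarrow> nat) monoid" where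
  "full_transf n =
     \<lparr>carrier = {1..n} \<rightarrow>\<^sub>E {1..n},
      mult = (\<lambda>f g. compose {1..n} g f),
      one = (\<lambda>x\<in>{1..n}. x)\<rparr>"

definition transf_rank :: "nat \<Rightarrow> (nat \<Rightarrow> nat) \<Rightarrow> nat" where
  "transf_rank n f = card (f ` {1..n})"

definition rank_class :: "nat \<Rightarrow> nat \<Rightarrow> (nat \<Rightarrow> nat) set" where
  "rank_class r n = {f \<in> carrier (full_transf n). transf_rank n f = r}"

text \<open>In \<^typ>\<open>enat\<close> the infimum of a nonempty set is its minimum, and that of \<open>{}\<close> is \<open>\<infinity>\<close>.\<close>

definition transf_degree :: "('a, 'm) monoid_scheme \<Rightarrow> enat" where
  "transf_degree S = Inf {enat n | n. n \<ge> 1 \<and> mon S (full_transf n) \<noteq> {}}"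

definition rectangular_band :: "'a set \<Rightarrow> 'b set \<Rightarrow> ('a \<times> 'b) monoid" where
  "rectangular_band P Q =
     \<lparr>carrier = P \<times> Q,
      mult = (\<lambda>(p\<^sub>1, q\<^sub>1) (p\<^sub>2, q\<^sub>2). (p\<^sub>1, q\<^sub>2)),
      one = undefined\<rparr>"

text \<open>All \<open>p \<times> q\<close> rectangular bands are isomorphic, so one on fixed index sets serves as the target.\<close>

definition band_degree :: "nat \<Rightarrow> nat \<Rightarrow> nat \<Rightarrow> enat" where
  "band_degree r p q =
     Inf {enat n | n. \<exists>H. H \<subseteq> rank_class r n \<and> subsemigroup H (full_transf n) \<and>
            (full_transf n)\<lparr>carrier := H\<rparr> \<cong> rectangular_band {1..p} {1..q}}"

end

theory Submission
  imports Defs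
begin

text \<open>
  The idempotents \<open>e\<^sub>i\<^sub>j = ((i, j), 1)\<close> of a rectangular group of transformations all have
  the same rank \<open>r\<close>, and the subgroup with identity \<open>e\<^sub>i\<^sub>j\<close> acts faithfully on the \<open>r\<close> points
  in the image of \<open>e\<^sub>i\<^sub>j\<close>, so \<open>r \<ge> \<mu>(G)\<close>. Conversely, given a rectangular band
  \<open>e\<^sub>i\<^sub>j\<close> of transformations of rank \<open>r \<ge> \<mu>(G)\<close>, let \<open>G\<close> act faithfully by permutations \<open>\<alpha>\<close>
  on the image of a fixed \<open>e\<^sub>a\<^sub>b\<close>; then \<open>((i, j), g) \<mapsto> e\<^sub>i\<^sub>b \<alpha>(g) e\<^sub>a\<^sub>j\<close> is an embedding.
\<close>

section \<open>Products and ranks of transformations\<close>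

lemma full_transf_simps:
  "carrier (full_transf n) = {1..n} \<rightarrow>\<^sub>E {1..n}"
  "x \<otimes>\<^bsub>full_transf n\<^esub> y = compose {1..n} y x"
  by (simp_all add: full_transf_def)

lemma rectangular_band_simps:
  "carrier (rectangular_band P Q) = P \<times> Q"
  "(i, j) \<otimes>\<^bsub>rectangular_band P Q\<^esub> (k, l) = (i, l)"
  by (simp_all add: rectangular_band_def)

lemma full_transf_in_carrier: "f \<in> carrier (full_transf n) \<Longrightarrow> x \<in> {1..n} \<Longrightarrow> f x \<in> {1..n}"
  by (auto simp: full_transf_simps)

lemma full_transf_eqI:
  assumes "f \<in> carrier (full_transf n)" "g \<in> carrier (full_transf n)"
    and "\<And>x. x \<in> {1..n} \<Longrightarrow> f x = g x"
  shows "f = g"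
  using assms unfolding full_transf_simps by (metis PiE_ext)

text \<open>The image of the product is the image under \<open>g\<close> of the image of
  \<open>f\<close>. These bounds later force all idempotents of a rectangular group to have one
  common rank.\<close>

lemma transf_rank_mult_le:
  assumes "f \<in> carrier (full_transf n)" "g \<in> carrier (full_transf n)"
  shows "transf_rank n (f \<otimes>\<^bsub>full_transf n\<^esub> g) \<le> transf_rank n f"
    and "transf_rank n (f \<otimes>\<^bsub>full_transf n\<^esub> g) \<le> transf_rank n g"
proof -
  have img: "(f \<otimes>\<^bsub>full_transf n\<^esub> g) ` {1..n} = g ` f ` {1..n}"
    by (auto simp: full_transf_simps compose_def)
  show "transf_rank n (f \<otimes>\<^bsub>full_transf n\<^esub> g) \<le> transf_rank n f"
    unfolding transf_rank_def img by (intro card_image_le) auto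
  have "g ` f ` {1..n} \<subseteq> g ` {1..n}"
    using full_transf_in_carrier[OF assms(1)] by blast
  then show "transf_rank n (f \<otimes>\<^bsub>full_transf n\<^esub> g) \<le> transf_rank n g"
    unfolding transf_rank_def img by (intro card_mono) auto
qed

section \<open>Faithful actions and the degree of a group\<close>

text \<open>A right action, matching the order of composition in \<open>full_transf\<close>. The
  point set \<open>X\<close> is arbitrary, so a group can act directly on the image of an idempotent
  without renumbering it.\<close>

definition faithful_action :: "('g, 'm) monoid_scheme \<Rightarrow> 'x set \<Rightarrow> ('g \<Rightarrow> 'x \<Rightarrow> 'x) \<Rightarrow> bool" where
  "faithful_action G X \<alpha> \<longleftrightarrow>
     (\<forall>g\<in>carrier G. \<forall>x\<in>X. \<alpha> g x \<in> X) \<and>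
     (\<forall>g\<in>carrier G. \<forall>h\<in>carrier G. \<forall>x\<in>X. \<alpha> (g \<otimes>\<^bsub>G\<^esub> h) x = \<alpha> h (\<alpha> g x)) \<and>
     (\<forall>x\<in>X. \<alpha> \<one>\<^bsub>G\<^esub> x = x) \<and>
     (\<forall>g\<in>carrier G. \<forall>h\<in>carrier G. (\<forall>x\<in>X. \<alpha> g x = \<alpha> h x) \<longrightarrow> g = h)"

text \<open>A semigroup embedding need not send \<open>\<one>\<close> to the identity map, hence the restriction to its image.\<close>

lemma (in monoid) faithful_action_of_mon:
  assumes "\<phi> \<in> mon G (full_transf n)"
  shows "faithful_action G (\<phi> \<one> ` {1..n}) \<phi>"
proof -
  have car: "\<phi> g \<in> carrier (full_transf n)" if "g \<in> carrier G" for g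
    using assms that by (auto simp: mon_def hom_def)
  have mult: "\<phi> (g \<otimes> h) x = \<phi> h (\<phi> g x)"
    if "g \<in> carrier G" "h \<in> carrier G" "x \<in> {1..n}" for g h x
    using assms that by (auto simp: mon_def hom_def full_transf_simps compose_def)
  have inj: "inj_on \<phi> (carrier G)"
    using assms by (simp add: mon_def)
  have sub: "x \<in> {1..n}" if "x \<in> \<phi> \<one> ` {1..n}" for x
    using full_transf_in_carrier[OF car[OF one_closed]] that by blast
  show ?thesis
    unfolding faithful_action_def
  proof (intro conjI ballI impI)
    fix g x assume g: "g \<in> carrier G" and x: "x \<in> \<phi> \<one> ` {1..n}"
    \<comment> \<open>As \<open>g = g \<otimes> \<one>\<close>, the map \<open>\<phi> g\<close>
      takes its values in the image of \<open>\<phi> \<one>\<close>.\<close>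
    have "\<phi> g x = \<phi> \<one> (\<phi> g x)"
      using mult[OF g one_closed sub[OF x]] g by simp
    then show "\<phi> g x \<in> \<phi> \<one> ` {1..n}"
      using full_transf_in_carrier[OF car[OF g] sub[OF x]] by blast
  next
    fix g h x assume "g \<in> carrier G" "h \<in> carrier G" "x \<in> \<phi> \<one> ` {1..n}"
    then show "\<phi> (g \<otimes> h) x = \<phi> h (\<phi> g x)"
      using mult sub by blast
  next
    fix x assume "x \<in> \<phi> \<one> ` {1..n}"
    then obtain y where y: "y \<in> {1..n}" "x = \<phi> \<one> y" by blast
    then show "\<phi> \<one> x = x"
      using mult[OF one_closed one_closed y(1)] by simp
  next
    fix g h assume g: "g \<in> carrier G" and h: "h \<in> carrier G"
      and eq: "\<forall>x\<in>\<phi> \<one> ` {1..n}. \<phi> g x = \<phi> h x"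
    \<comment> \<open>As \<open>g = \<one> \<otimes> g\<close>, the map \<open>\<phi> g\<close>
      factors through \<open>\<phi> \<one>\<close>, so its values on the image of
      \<open>\<phi> \<one>\<close> determine it; likewise for \<open>h\<close>.\<close>
    have "\<phi> g = \<phi> h"
    proof (rule full_transf_eqI[OF car[OF g] car[OF h]])
      fix y assume y: "y \<in> {1..n}"
      then show "\<phi> g y = \<phi> h y"
        using mult[OF one_closed g y] mult[OF one_closed h y] eq g h by simp
    qed
    then show "g = h"
      using inj g h by (auto dest: inj_onD)
  qed
qed

text \<open>The points outside the image of \<open>X\<close> are fixed.\<close>

lemma (in monoid) faithful_action_extend:
  assumes act: "faithful_action G X \<alpha>" and f: "inj_on f X" "f ` X \<subseteq> A"
  shows "\<exists>\<beta>. faithful_action G A \<beta>"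
proof -
  define \<beta> where
    "\<beta> g y = (if y \<in> f ` X then f (\<alpha> g (inv_into X f y)) else y)" for g y
  have on: "\<beta> g (f x) = f (\<alpha> g x)" if "x \<in> X" for g x
    using that f by (simp add: \<beta>_def)
  have off: "\<beta> g y = y" if "y \<notin> f ` X" for g y
    using that by (simp add: \<beta>_def)
  have cl: "\<alpha> g x \<in> X" if "g \<in> carrier G" "x \<in> X" for g x
    using act that by (simp add: faithful_action_def)
  have "faithful_action G A \<beta>"
    unfolding faithful_action_def
  proof (intro conjI ballI impI)
    fix g y assume "g \<in> carrier G" "y \<in> A"
    then show "\<beta> g y \<in> A"
      using f(2) cl on off by (cases "y \<in> f ` X") auto
  next
    fix g h y assume "g \<in> carrier G" "h \<in> carrier G" "y \<in> A"
    then show "\<beta> (g \<otimes> h) y = \<beta> h (\<beta> g y)"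
      using act on off cl by (cases "y \<in> f ` X") (auto simp: faithful_action_def)
  next
    fix y
    show "\<beta> \<one> y = y"
      using act on off by (cases "y \<in> f ` X") (auto simp: faithful_action_def)
  next
    fix g h assume g: "g \<in> carrier G" and h: "h \<in> carrier G" and eq: "\<forall>y\<in>A. \<beta> g y = \<beta> h y"
    have "\<alpha> g x = \<alpha> h x" if x: "x \<in> X" for x
    proof -
      have "f (\<alpha> g x) = f (\<alpha> h x)"
        using eq f(2) on[OF x] x by fastforce
      then show ?thesis
        using f(1) cl[OF g x] cl[OF h x] by (auto dest: inj_onD)
    qed
    then show "g = h"
      using act g h by (auto simp: faithful_action_def)
  qed
  then show ?thesis by blast
qed

lemma (in monoid) mon_of_faithful_action:
  assumes act: "faithful_action G {1..n} \<alpha>"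
  shows "(\<lambda>g. restrict (\<alpha> g) {1..n}) \<in> mon G (full_transf n)"
proof -
  have cl: "\<alpha> g x \<in> {1..n}" if "g \<in> carrier G" "x \<in> {1..n}" for g x
    using act that by (simp add: faithful_action_def)
  have "(\<lambda>g. restrict (\<alpha> g) {1..n}) \<in> hom G (full_transf n)"
  proof (rule homI)
    fix g assume "g \<in> carrier G"
    then show "restrict (\<alpha> g) {1..n} \<in> carrier (full_transf n)"
      using cl by (auto simp: full_transf_simps)
  next
    fix g h assume "g \<in> carrier G" "h \<in> carrier G"
    then show "restrict (\<alpha> (g \<otimes> h)) {1..n}
        = restrict (\<alpha> g) {1..n} \<otimes>\<^bsub>full_transf n\<^esub> restrict (\<alpha> h) {1..n}"
      using act cl unfolding full_transf_simps compose_def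
      by (intro restrict_ext) (auto simp: faithful_action_def)
  qed
  moreover have "inj_on (\<lambda>g. restrict (\<alpha> g) {1..n}) (carrier G)"
  proof (rule inj_onI)
    fix g h assume gh: "g \<in> carrier G" "h \<in> carrier G"
      and eq: "restrict (\<alpha> g) {1..n} = restrict (\<alpha> h) {1..n}"
    have "\<forall>x\<in>{1..n}. \<alpha> g x = \<alpha> h x"
      using eq by (metis restrict_apply')
    then show "g = h"
      using act gh by (simp add: faithful_action_def)
  qed
  ultimately show ?thesis by (simp add: mon_def)
qed

text \<open>A finite bound excludes the empty set, whose infimum is \<infinity>; a nonempty set of
  extended naturals contains its infimum by well-ordering.\<close>

lemma Inf_enat_attained:
  fixes A :: "enat set"
  assumes "Inf A \<le> enat r"
  obtains n where "enat n \<in> A" "n \<le> r"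
proof -
  have "A \<noteq> {}"
    using assms by (auto simp: top_enat_def)
  then have "Inf A \<in> A"
    by (metis Inf_enat_def LeastI_ex all_not_in_conv)
  moreover obtain n where "Inf A = enat n" "n \<le> r"
    using assms by (metis enat_ile enat_ord_simps(1))
  ultimately show ?thesis
    using that by metis
qed

text \<open>An embedding into \<open>full_transf m\<close> with \<open>m \<le> card A\<close> gives
  a faithful action on the image of \<open>\<phi> \<one>\<close>. This set has at most
  \<open>m\<close> points, so it injects into \<open>A\<close>, and the action is carried over along
  the injection.\<close>

lemma (in monoid) faithful_action_if_degree_le:
  assumes "transf_degree G \<le> enat (card A)" "finite A"
  obtains \<alpha> where "faithful_action G A \<alpha>"
proof -
  obtain m where m: "m \<le> card A" and "mon G (full_transf m) \<noteq> {}"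
    using Inf_enat_attained[OF assms(1)[unfolded transf_degree_def]] by blast
  then obtain \<phi> where \<phi>: "\<phi> \<in> mon G (full_transf m)" by blast
  have "card (\<phi> \<one> ` {1..m}) \<le> card A"
    using card_image_le[of "{1..m}" "\<phi> \<one>"] m by simp
  then obtain f where "f ` \<phi> \<one> ` {1..m} \<subseteq> A" "inj_on f (\<phi> \<one> ` {1..m})"
    using card_le_inj[of "\<phi> \<one> ` {1..m}" A] assms(2) by auto
  then show ?thesis
    using faithful_action_extend[OF faithful_action_of_mon[OF \<phi>]] that by blast
qed

text \<open>The faithful action on the image of \<open>\<phi> \<one>\<close> is renumbered to one on
  \<open>{1..r}\<close>, where \<open>r\<close> is the rank of \<open>\<phi> \<one>\<close>, and
  then read as an embedding into \<open>full_transf r\<close>.\<close>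

lemma (in monoid) degree_le_rank_one:
  assumes "\<phi> \<in> mon G (full_transf n)" "n \<ge> 1"
  shows "transf_degree G \<le> enat (transf_rank n (\<phi> \<one>))"
proof -
  let ?X = "\<phi> \<one> ` {1..n}" and ?r = "transf_rank n (\<phi> \<one>)"
  have "card {1..?r} = card ?X"
    by (simp add: transf_rank_def)
  then obtain f where "bij_betw f ?X {1..?r}"
    using finite_same_card_bij[of ?X "{1..?r}"] by auto
  then obtain \<beta> where "faithful_action G {1..?r} \<beta>"
    using faithful_action_extend[OF faithful_action_of_mon[OF assms(1)], of f "{1..?r}"]
    by (auto simp: bij_betw_def)
  then have "mon G (full_transf ?r) \<noteq> {}"
    using mon_of_faithful_action by blast
  \<comment> \<open>The set defining the degree admits only positive \<open>n\<close>; a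
    transformation of a nonempty set has positive rank.\<close>
  moreover have "?r \<ge> 1"
    using assms(2) by (simp add: transf_rank_def Suc_le_eq card_gt_0_iff)
  ultimately show ?thesis
    unfolding transf_degree_def by (intro Inf_lower) blast
qed

section \<open>Rectangular bands of constant rank as embeddings\<close>

text \<open>Replaces subsemigroups isomorphic to the numbered band by embeddings of the band on the
  given index sets, which can be composed with other maps directly. An embedding and an isomorphism
  from its image are mutually inverse up to the renumbering \<open>w\<close>.\<close>

lemma band_degree_eq_Inf_mon:
  assumes P: "finite P" "P \<noteq> {}" and Q: "finite Q" "Q \<noteq> {}"
  shows "band_degree r (card P) (card Q) =
    Inf {enat n | n. \<exists>e \<in> mon (rectangular_band P Q) (full_transf n). e ` (P \<times> Q) \<subseteq> rank_class r n}"
proof -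
  obtain u where u: "bij_betw u P {1..card P}"
    using finite_same_card_bij[OF P(1), of "{1..card P}"] by auto
  obtain v where v: "bij_betw v Q {1..card Q}"
    using finite_same_card_bij[OF Q(1), of "{1..card Q}"] by auto
  let ?B = "rectangular_band {1..card P} {1..card Q}"
  define w where "w = map_prod u v"
  have w: "bij_betw w (P \<times> Q) ({1..card P} \<times> {1..card Q})"
    unfolding w_def using u v by (rule bij_betw_map_prod)
  have w_mult: "w (x \<otimes>\<^bsub>rectangular_band P Q\<^esub> y) = w x \<otimes>\<^bsub>?B\<^esub> w y" for x y
    by (cases x; cases y) (simp add: w_def rectangular_band_simps)
  have "(\<exists>H. H \<subseteq> rank_class r n \<and> subsemigroup H (full_transf n) \<and>
            (full_transf n)\<lparr>carrier := H\<rparr> \<cong> ?B) \<longleftrightarrow>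
        (\<exists>e \<in> mon (rectangular_band P Q) (full_transf n). e ` (P \<times> Q) \<subseteq> rank_class r n)"
    (is "?L \<longleftrightarrow> ?R") for n
  proof
    assume ?L
    then obtain H h where H: "H \<subseteq> rank_class r n" "subsemigroup H (full_transf n)"
      and h: "h \<in> hom ((full_transf n)\<lparr>carrier := H\<rparr>) ?B"
      and bij: "bij_betw h H ({1..card P} \<times> {1..card Q})"
      by (auto simp: is_iso_def iso_def rectangular_band_simps)
    define e where "e x = inv_into H h (w x)" for x
    have e_bij: "bij_betw e (P \<times> Q) H"
      using bij_betw_trans[OF w bij_betw_inv_into[OF bij]] by (simp add: e_def[abs_def] comp_def)
    have he: "h (e x) = w x" if "x \<in> P \<times> Q" for x
      using that bij w by (metis bij_betw_apply bij_betw_inv_into_right e_def)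
    have "e \<in> hom (rectangular_band P Q) (full_transf n)"
    proof (rule homI)
      fix x assume "x \<in> carrier (rectangular_band P Q)"
      then show "e x \<in> carrier (full_transf n)"
        using e_bij H(2) by (auto simp: rectangular_band_simps subsemigroup_def bij_betw_def)
    next
      fix x y assume "x \<in> carrier (rectangular_band P Q)" "y \<in> carrier (rectangular_band P Q)"
      then have xy: "x \<in> P \<times> Q" "y \<in> P \<times> Q"
        by (simp_all add: rectangular_band_simps)
      then have xy': "x \<otimes>\<^bsub>rectangular_band P Q\<^esub> y \<in> P \<times> Q"
        by (cases x; cases y) (simp add: rectangular_band_simps)
      have eH: "e x \<in> H" "e y \<in> H" "e (x \<otimes>\<^bsub>rectangular_band P Q\<^esub> y) \<in> H"
        using e_bij xy xy' by (auto simp: bij_betw_def)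
      \<comment> \<open>Both sides of the goal lie in \<open>H\<close>, where \<open>h\<close> is
        injective, so it suffices to compare their images under \<open>h\<close>.\<close>
      have "h (e x \<otimes>\<^bsub>full_transf n\<^esub> e y) = h (e x) \<otimes>\<^bsub>?B\<^esub> h (e y)"
        using h eH by (simp add: hom_def)
      also have "\<dots> = h (e (x \<otimes>\<^bsub>rectangular_band P Q\<^esub> y))"
        using he xy xy' w_mult by simp
      finally show "e (x \<otimes>\<^bsub>rectangular_band P Q\<^esub> y) = e x \<otimes>\<^bsub>full_transf n\<^esub> e y"
        using bij eH H(2) unfolding bij_betw_def subsemigroup_def by (metis inj_onD)
    qed
    then show ?R
      using e_bij H(1) by (auto simp: mon_def bij_betw_def rectangular_band_simps intro!: bexI[of _ e])
  next
    assume ?R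
    then obtain e where e: "e \<in> hom (rectangular_band P Q) (full_transf n)"
      and inj: "inj_on e (P \<times> Q)" and rank: "e ` (P \<times> Q) \<subseteq> rank_class r n"
      by (auto simp: mon_def rectangular_band_simps)
    let ?H = "e ` (P \<times> Q)"
    have e_mult: "e x \<otimes>\<^bsub>full_transf n\<^esub> e y = e (x \<otimes>\<^bsub>rectangular_band P Q\<^esub> y)"
      if "x \<in> P \<times> Q" "y \<in> P \<times> Q" for x y
      using hom_mult[OF e] that by (simp add: rectangular_band_simps(1))
    have cl: "x \<otimes>\<^bsub>rectangular_band P Q\<^esub> y \<in> P \<times> Q" if "x \<in> P \<times> Q" "y \<in> P \<times> Q" for x y
      using that by (cases x; cases y) (simp add: rectangular_band_simps)
    have sub: "subsemigroup ?H (full_transf n)"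
      unfolding subsemigroup_def
    proof (intro conjI ballI)
      show "?H \<subseteq> carrier (full_transf n)"
        using rank by (auto simp: rank_class_def)
      show "?H \<noteq> {}"
        using P Q by auto
    next
      fix a b assume "a \<in> ?H" "b \<in> ?H"
      then obtain x y where "x \<in> P \<times> Q" "y \<in> P \<times> Q" "a = e x" "b = e y" by blast
      then show "a \<otimes>\<^bsub>full_transf n\<^esub> b \<in> ?H"
        using e_mult cl by simp
    qed
    define h where "h a = w (inv_into (P \<times> Q) e a)" for a
    have he: "h (e x) = w x" if "x \<in> P \<times> Q" for x
      using that inj by (simp add: h_def)
    have h_bij: "bij_betw h ?H ({1..card P} \<times> {1..card Q})"
      using bij_betw_trans[OF bij_betw_inv_into[OF inj_on_imp_bij_betw[OF inj]] w]
      by (simp add: h_def[abs_def] comp_def)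
    have "h \<in> hom ((full_transf n)\<lparr>carrier := ?H\<rparr>) ?B"
    proof (rule homI)
      fix a assume "a \<in> carrier ((full_transf n)\<lparr>carrier := ?H\<rparr>)"
      then show "h a \<in> carrier ?B"
        using bij_betw_apply[OF h_bij, of a] by (simp add: rectangular_band_simps)
    next
      fix a b assume "a \<in> carrier ((full_transf n)\<lparr>carrier := ?H\<rparr>)"
        "b \<in> carrier ((full_transf n)\<lparr>carrier := ?H\<rparr>)"
      then have "a \<in> ?H" "b \<in> ?H" by simp_all
      then obtain x y where "x \<in> P \<times> Q" "y \<in> P \<times> Q" "a = e x" "b = e y" by blast
      then show "h (a \<otimes>\<^bsub>(full_transf n)\<lparr>carrier := ?H\<rparr>\<^esub> b) = h a \<otimes>\<^bsub>?B\<^esub> h b"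
        using he e_mult cl w_mult by simp
    qed
    then have "h \<in> iso ((full_transf n)\<lparr>carrier := ?H\<rparr>) ?B"
      using h_bij by (simp add: iso_def rectangular_band_simps)
    then show ?L
      using rank sub unfolding is_iso_def by blast
  qed
  then show ?thesis
    unfolding band_degree_def by simp
qed

section \<open>From a band of rank at least the degree to the rectangular group\<close>

text \<open>The map for \<open>((i, j), g)\<close> goes into \<open>A\<close> by
  \<open>e (i, b)\<close>, permutes \<open>A\<close> by \<alpha>, and leaves by
  \<open>e (a, j)\<close>. Products come out right because \<open>e (k, b)\<close> undoes any
  \<open>e (a, j)\<close> on \<open>A\<close>.\<close>

lemma (in group) rectangular_group_mon_of_band:
  assumes ne: "P \<noteq> {}" "Q \<noteq> {}"
    and e: "e \<in> mon (rectangular_band P Q) (full_transf n)" "e ` (P \<times> Q) \<subseteq> rank_class r n"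
    and deg: "transf_degree G \<le> enat r"
  shows "mon (rectangular_band P Q \<times>\<times> G) (full_transf n) \<noteq> {}"
proof -
  obtain a b where ab: "a \<in> P" "b \<in> Q" using ne by blast
  define A where "A = e (a, b) ` {1..n}"
  have hom: "e \<in> hom (rectangular_band P Q) (full_transf n)"
    using e(1) by (simp add: mon_def)
  have car: "e (i, j) \<in> carrier (full_transf n)" if "i \<in> P" "j \<in> Q" for i j
    using hom_in_carrier[OF hom] that by (simp add: rectangular_band_simps)
  have e_in: "e (i, j) x \<in> {1..n}" if "i \<in> P" "j \<in> Q" "x \<in> {1..n}" for i j x
    using full_transf_in_carrier[OF car] that by blast
  have mult: "e (k, l) (e (i, j) x) = e (i, l) x"
    if "i \<in> P" "j \<in> Q" "k \<in> P" "l \<in> Q" "x \<in> {1..n}" for i j k l x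
  proof -
    have "e ((i, j) \<otimes>\<^bsub>rectangular_band P Q\<^esub> (k, l)) = e (i, j) \<otimes>\<^bsub>full_transf n\<^esub> e (k, l)"
      using that by (intro hom_mult[OF hom]) (simp_all add: rectangular_band_simps)
    then show ?thesis
      using that by (simp add: rectangular_band_simps full_transf_simps compose_def)
  qed
  have e_inj: "i = k \<and> j = l"
    if "i \<in> P" "j \<in> Q" "k \<in> P" "l \<in> Q" "\<And>x. x \<in> {1..n} \<Longrightarrow> e (i, j) x = e (k, l) x" for i j k l
  proof -
    have "e (i, j) = e (k, l)"
      using that car by (intro full_transf_eqI) auto
    then show ?thesis
      using e(1) that(1-4) inj_onD[of e "P \<times> Q" "(i, j)" "(k, l)"]
      by (simp add: mon_def rectangular_band_simps)
  qed
  have "finite A" "card A = r"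
    using e(2) ab by (auto simp: A_def rank_class_def transf_rank_def)
  then obtain \<alpha> where act: "faithful_action G A \<alpha>"
    using faithful_action_if_degree_le deg by metis
  have A_sub: "x \<in> {1..n}" if "x \<in> A" for x
    using that e_in ab unfolding A_def by blast
  have A_fix: "e (a, b) x = x" if "x \<in> A" for x
    using that mult ab unfolding A_def by auto
  \<comment> \<open>In the band \<open>(i, b) = (i, b) (a, b)\<close>, so every
    \<open>e (i, b)\<close> has its image inside that of \<open>e (a, b)\<close>.\<close>
  have in_A: "e (i, b) x \<in> A" if "i \<in> P" "x \<in> {1..n}" for i x
  proof -
    have "e (i, b) x = e (a, b) (e (i, b) x)"
      using mult that ab by simp
    then show ?thesis
      using e_in[OF that(1) ab(2) that(2)] unfolding A_def by blast
  qed
  have \<alpha>_in: "\<alpha> g x \<in> A" if "g \<in> carrier G" "x \<in> A" for g x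
    using act that by (simp add: faithful_action_def)
  have \<alpha>_mult: "\<alpha> (g \<otimes> h) x = \<alpha> h (\<alpha> g x)" if "g \<in> carrier G" "h \<in> carrier G" "x \<in> A" for g h x
    using act that by (simp add: faithful_action_def)
  have \<alpha>_one: "\<alpha> \<one> x = x" if "x \<in> A" for x
    using act that by (simp add: faithful_action_def)
  define \<psi> where "\<psi> = (\<lambda>((i, j), g). \<lambda>x\<in>{1..n}. e (a, j) (\<alpha> g (e (i, b) x)))"
  have \<psi>: "\<psi> ((i, j), g) x = e (a, j) (\<alpha> g (e (i, b) x))" if "x \<in> {1..n}" for i j g x
    using that by (simp add: \<psi>_def)
  have \<psi>_in: "\<psi> ((i, j), g) x \<in> {1..n}"
    if "i \<in> P" "j \<in> Q" "g \<in> carrier G" "x \<in> {1..n}" for i j g x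
    using \<psi> that ab A_sub \<alpha>_in in_A e_in by metis
  have \<psi>_mult: "\<psi> ((k, l), h) (\<psi> ((i, j), g) x) = \<psi> ((i, l), g \<otimes> h) x"
    if "i \<in> P" "j \<in> Q" "g \<in> carrier G" "k \<in> P" "l \<in> Q" "h \<in> carrier G" "x \<in> {1..n}"
    for i j g k l h x
  proof -
    have y: "e (i, b) x \<in> A" "\<alpha> g (e (i, b) x) \<in> A"
      using that in_A \<alpha>_in by auto
    \<comment> \<open>For \<open>y\<close> in \<open>A\<close>,
      \<open>e (k, b) (e (a, j) y) = e (a, b) y = y\<close>, because
      \<open>(a, j) (k, b) = (a, b)\<close>.\<close>
    have "e (k, b) (\<psi> ((i, j), g) x) = \<alpha> g (e (i, b) x)"
      using that y ab A_sub A_fix mult \<psi> by metis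
    then show ?thesis
      using \<psi>[OF \<psi>_in] \<psi> \<alpha>_mult y that by metis
  qed
  have "\<psi> \<in> hom (rectangular_band P Q \<times>\<times> G) (full_transf n)"
  proof (rule homI)
    fix s assume "s \<in> carrier (rectangular_band P Q \<times>\<times> G)"
    then obtain i j g where s: "s = ((i, j), g)" "i \<in> P" "j \<in> Q" "g \<in> carrier G"
      by (auto simp: DirProd_def rectangular_band_simps)
    have "\<psi> s \<in> extensional {1..n}"
      by (simp add: s(1) \<psi>_def)
    then show "\<psi> s \<in> carrier (full_transf n)"
      using \<psi>_in s unfolding full_transf_simps PiE_def by blast
  next
    fix s t assume "s \<in> carrier (rectangular_band P Q \<times>\<times> G)"
      "t \<in> carrier (rectangular_band P Q \<times>\<times> G)"
    then obtain i j g k l h where st: "s = ((i, j), g)" "t = ((k, l), h)"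
      "i \<in> P" "j \<in> Q" "g \<in> carrier G" "k \<in> P" "l \<in> Q" "h \<in> carrier G"
      by (auto simp: DirProd_def rectangular_band_simps)
    have "\<psi> ((i, l), g \<otimes> h) = compose {1..n} (\<psi> t) (\<psi> s)"
    proof (rule extensionalityI)
      show "\<psi> ((i, l), g \<otimes> h) \<in> extensional {1..n}"
        by (simp add: \<psi>_def)
    qed (use st \<psi>_mult in \<open>simp_all add: compose_def\<close>)
    then show "\<psi> (s \<otimes>\<^bsub>rectangular_band P Q \<times>\<times> G\<^esub> t) = \<psi> s \<otimes>\<^bsub>full_transf n\<^esub> \<psi> t"
      by (simp add: st rectangular_band_simps full_transf_simps)
  qed
  moreover have "inj_on \<psi> (carrier (rectangular_band P Q \<times>\<times> G))"
  proof (rule inj_onI)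
    fix s t assume "s \<in> carrier (rectangular_band P Q \<times>\<times> G)"
      "t \<in> carrier (rectangular_band P Q \<times>\<times> G)" and eq: "\<psi> s = \<psi> t"
    then obtain i j g k l h where st: "s = ((i, j), g)" "t = ((k, l), h)"
      and i: "i \<in> P" and j: "j \<in> Q" and g: "g \<in> carrier G"
      and k: "k \<in> P" and l: "l \<in> Q" and h: "h \<in> carrier G"
      by (auto simp: DirProd_def rectangular_band_simps)
    have val: "e (a, j) (\<alpha> g (e (i, b) x)) = e (a, l) (\<alpha> h (e (k, b) x))" if "x \<in> {1..n}" for x
      using eq \<psi>[OF that] st by metis
    \<comment> \<open>Applying \<open>e (a, b)\<close> to both sides of \<open>val\<close> cancels
      \<open>e (a, j)\<close> and \<open>e (a, l)\<close> on \<open>A\<close>.\<close>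
    have \<alpha>_eq: "\<alpha> g (e (i, b) x) = \<alpha> h (e (k, b) x)" if x: "x \<in> {1..n}" for x
    proof -
      have y: "\<alpha> g (e (i, b) x) \<in> A" "\<alpha> h (e (k, b) x) \<in> A"
        using \<alpha>_in in_A g h i k x by auto
      have "e (a, b) (e (a, j) (\<alpha> g (e (i, b) x))) = \<alpha> g (e (i, b) x)"
        using mult[OF ab(1) j ab A_sub] A_fix y by simp
      moreover have "e (a, b) (e (a, l) (\<alpha> h (e (k, b) x))) = \<alpha> h (e (k, b) x)"
        using mult[OF ab(1) l ab A_sub] A_fix y by simp
      ultimately show ?thesis
        using val[OF x] by simp
    qed
    \<comment> \<open>Both \<open>e (i, b)\<close> and \<open>e (k, b)\<close> fix \<open>A\<close>
      pointwise, so \<open>\<alpha> g\<close> and \<open>\<alpha> h\<close> agree on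
      \<open>A\<close> and faithfulness applies.\<close>
    have gh: "g = h"
    proof -
      have "\<alpha> g x = \<alpha> h x" if x: "x \<in> A" for x
      proof -
        have "e (i, b) x = x" "e (k, b) x = x"
          using x mult ab i k unfolding A_def by auto
        then show ?thesis
          using \<alpha>_eq[OF A_sub[OF x]] by simp
      qed
      then show ?thesis
        using act g h by (simp add: faithful_action_def)
    qed
    have \<alpha>_inv: "\<alpha> (inv g) (\<alpha> g x) = x" if "x \<in> A" for x
      using \<alpha>_mult[OF g inv_closed[OF g] that] \<alpha>_one[OF that] g by simp
    \<comment> \<open>With \<open>g = h\<close>, acting by \<open>inv g\<close> removes the
      permutation from \<open>\<alpha>_eq\<close>.\<close>
    have "e (i, b) x = e (k, b) x" if x: "x \<in> {1..n}" for x
      using \<alpha>_eq[OF x] \<alpha>_inv in_A i k x gh by metis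
    then have ik: "i = k"
      using e_inj i k ab by blast
    have "e (a, j) x = e (a, l) x" if x: "x \<in> {1..n}" for x
    proof -
      let ?y = "e (a, b) x"
      have y: "?y \<in> A"
        using in_A ab x by blast
      \<comment> \<open>The point \<open>?z\<close> is chosen so that \<open>e (i, b)\<close>
        followed by \<open>\<alpha> g\<close> sends it to \<open>?y\<close>. Hence
        \<open>val\<close> compares \<open>e (a, j)\<close> and \<open>e (a, l)\<close> at
        \<open>?y\<close>, and \<open>(a, b) (a, j) = (a, j)\<close> carries this back to
        \<open>x\<close>.\<close>
      let ?z = "\<alpha> (inv g) ?y"
      have z: "?z \<in> A"
        using \<alpha>_in y g by simp
      have "e (i, b) ?z = ?z"
        using z mult ab i unfolding A_def by auto
      moreover have "\<alpha> g ?z = ?y"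
        using \<alpha>_mult[OF inv_closed[OF g] g y] \<alpha>_one[OF y] g by simp
      ultimately have "e (a, j) ?y = e (a, l) ?y"
        using val[OF A_sub[OF z]] ik gh by simp
      then show ?thesis
        using mult ab j l x by simp
    qed
    then have "j = l"
      using e_inj j l ab by blast
    then show "s = t"
      using st ik gh by simp
  qed
  ultimately show ?thesis
    by (auto simp: mon_def)
qed

section \<open>From an embedded rectangular group to a band of constant rank\<close>

text \<open>The band consists of the images of the elements \<open>(x, \<one>)\<close>. Its common
  rank is at least the degree of \<open>G\<close>, because the copy of \<open>G\<close> over
  \<open>(a, b)\<close> is embedded with \<open>\<one>\<close> sent to
  \<open>e (a, b)\<close>.\<close>

lemma (in monoid) band_of_rectangular_group_mon:
  assumes ne: "P \<noteq> {}" "Q \<noteq> {}"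
    and \<phi>: "\<phi> \<in> mon (rectangular_band P Q \<times>\<times> G) (full_transf n)" and n: "n \<ge> 1"
  shows "\<exists>r. transf_degree G \<le> enat r \<and>
    (\<exists>e \<in> mon (rectangular_band P Q) (full_transf n). e ` (P \<times> Q) \<subseteq> rank_class r n)"
proof -
  obtain a b where ab: "a \<in> P" "b \<in> Q" using ne by blast
  have hom: "\<phi> \<in> hom (rectangular_band P Q \<times>\<times> G) (full_transf n)"
    using \<phi> by (simp add: mon_def)
  have car: "\<phi> ((i, j), g) \<in> carrier (full_transf n)"
    if "i \<in> P" "j \<in> Q" "g \<in> carrier G" for i j g
    using hom_in_carrier[OF hom] that by (simp add: rectangular_band_simps)
  have mult: "\<phi> ((i, l), g \<otimes> h) = \<phi> ((i, j), g) \<otimes>\<^bsub>full_transf n\<^esub> \<phi> ((k, l), h)"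
    if "i \<in> P" "j \<in> Q" "g \<in> carrier G" "k \<in> P" "l \<in> Q" "h \<in> carrier G" for i j g k l h
  proof -
    have "\<phi> (((i, j), g) \<otimes>\<^bsub>rectangular_band P Q \<times>\<times> G\<^esub> ((k, l), h)) =
        \<phi> ((i, j), g) \<otimes>\<^bsub>full_transf n\<^esub> \<phi> ((k, l), h)"
      using that by (intro hom_mult[OF hom]) (simp_all add: rectangular_band_simps)
    then show ?thesis
      by (simp add: rectangular_band_simps)
  qed
  have inj: "inj_on \<phi> ((P \<times> Q) \<times> carrier G)"
    using \<phi> by (simp add: mon_def rectangular_band_simps)
  define e where "e x = \<phi> (x, \<one>)" for x
  define r where "r = transf_rank n (e (a, b))"
  have "(\<lambda>g. \<phi> ((a, b), g)) \<in> mon G (full_transf n)"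
    using car mult ab inj by (auto simp: mon_def hom_def inj_on_def)
  then have "transf_degree G \<le> enat r"
    unfolding r_def e_def by (rule degree_le_rank_one[OF _ n])
  moreover have "e \<in> mon (rectangular_band P Q) (full_transf n)"
    unfolding mon_def hom_def
  proof (intro CollectI conjI ballI PiE_I Pi_I)
    fix x assume "x \<in> carrier (rectangular_band P Q)"
    then show "e x \<in> carrier (full_transf n)"
      using car by (auto simp: e_def rectangular_band_simps)
  next
    fix x y assume "x \<in> carrier (rectangular_band P Q)" "y \<in> carrier (rectangular_band P Q)"
    then obtain i j k l where "x = (i, j)" "y = (k, l)" "i \<in> P" "j \<in> Q" "k \<in> P" "l \<in> Q"
      by (auto simp: rectangular_band_simps)
    then show "e (x \<otimes>\<^bsub>rectangular_band P Q\<^esub> y) = e x \<otimes>\<^bsub>full_transf n\<^esub> e y"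
      using mult[of i j \<one> k l \<one>] by (simp add: e_def rectangular_band_simps)
  next
    show "inj_on e (carrier (rectangular_band P Q))"
      using inj_onD[OF inj] by (fastforce simp: e_def rectangular_band_simps intro: inj_onI)
  qed
  moreover have "e ` (P \<times> Q) \<subseteq> rank_class r n"
  proof -
    \<comment> \<open>The comparison passes through \<open>(i, l)\<close>:
      \<open>(i, j) = (i, l) (k, j)\<close> bounds by a left factor,
      \<open>(i, l) = (i, j) (k, l)\<close> by a right factor. Exchanging the two pairs of indices
      then gives equality.\<close>
    have rank_le: "transf_rank n (e (i, j)) \<le> transf_rank n (e (k, l))"
      if "i \<in> P" "j \<in> Q" "k \<in> P" "l \<in> Q" for i j k l
    proof -
      have "transf_rank n (e (i, j)) \<le> transf_rank n (e (i, l))"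
        using mult[of i l \<one> k j \<one>] transf_rank_mult_le(1) car that by (simp add: e_def)
      also have "\<dots> \<le> transf_rank n (e (k, l))"
        using mult[of i j \<one> k l \<one>] transf_rank_mult_le(2) car that by (simp add: e_def)
      finally show ?thesis .
    qed
    then have "transf_rank n (e (i, j)) = r" if "i \<in> P" "j \<in> Q" for i j
      using that ab unfolding r_def by (intro antisym) auto
    then show ?thesis
      using car by (auto simp: rank_class_def e_def)
  qed
  ultimately show ?thesis by blast
qed

section \<open>The degree of a rectangular group\<close>

theorem theorem3p12:
  fixes P :: "'a set" and Q :: "'b set" and G :: "('g, 'm) monoid_scheme"
    and S :: "(('a \<times> 'b) \<times> 'g) monoid" and p q :: nat
  assumes "group G"
    and "finite P" and "P \<noteq> {}" and "card P = p"
    and "finite Q" and "Q \<noteq> {}" and "card Q = q"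
    and "S = rectangular_band P Q \<times>\<times> G"
    and "finite (carrier S)"
  shows "transf_degree S = (INF r\<in>{r :: nat. enat r \<ge> transf_degree G}. band_degree r p q)"
proof (rule antisym)
  have band: "band_degree r p q = Inf {enat n | n.
      \<exists>e \<in> mon (rectangular_band P Q) (full_transf n). e ` (P \<times> Q) \<subseteq> rank_class r n}" for r
    using band_degree_eq_Inf_mon assms(2-7) by blast
  interpret group G by fact
  show "transf_degree S \<le> (INF r\<in>{r. enat r \<ge> transf_degree G}. band_degree r p q)"
  proof (rule INF_greatest)
    fix r assume "r \<in> {r. enat r \<ge> transf_degree G}"
    then have r: "transf_degree G \<le> enat r" by simp
    \<comment> \<open>The degree of \<open>G\<close> is an infimum over positive integers, so
      \<open>r\<close> is positive; this is what rules out \<open>n = 0\<close> below.\<close>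
    obtain m where "m \<ge> 1" "m \<le> r"
      using Inf_enat_attained[OF r[unfolded transf_degree_def]] by auto
    then have r1: "r \<ge> 1" by simp
    show "transf_degree S \<le> band_degree r p q"
      unfolding band
    proof (rule Inf_greatest)
      fix d assume "d \<in> {enat n | n.
        \<exists>e \<in> mon (rectangular_band P Q) (full_transf n). e ` (P \<times> Q) \<subseteq> rank_class r n}"
      then obtain n e where d: "d = enat n" and e: "e \<in> mon (rectangular_band P Q) (full_transf n)"
        "e ` (P \<times> Q) \<subseteq> rank_class r n" by blast
      have "mon S (full_transf n) \<noteq> {}"
        using rectangular_group_mon_of_band[OF assms(3,6) e r] assms(8) by simp
      \<comment> \<open>The infimum in \<open>band_degree\<close> ranges over all \<open>n\<close>,
        that in \<open>transf_degree\<close> only over positive \<open>n\<close>. On the empty set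
        the only transformation has rank 0, which differs from \<open>r\<close>.\<close>
      moreover have "n \<noteq> 0"
      proof
        assume "n = 0"
        then have "rank_class r n = {}"
          using r1 by (auto simp: rank_class_def transf_rank_def)
        then show False
          using e(2) assms(3,6) by auto
      qed
      ultimately show "transf_degree S \<le> d"
        unfolding transf_degree_def d by (intro Inf_lower) auto
    qed
  qed
  show "(INF r\<in>{r. enat r \<ge> transf_degree G}. band_degree r p q) \<le> transf_degree S"
    unfolding transf_degree_def[of S]
  proof (rule Inf_greatest)
    fix d assume "d \<in> {enat n | n. n \<ge> 1 \<and> mon S (full_transf n) \<noteq> {}}"
    then obtain n \<phi> where d: "d = enat n" and n: "n \<ge> 1" and \<phi>: "\<phi> \<in> mon S (full_transf n)"
      by blast
    obtain r where r: "transf_degree G \<le> enat r"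
      and e: "\<exists>e \<in> mon (rectangular_band P Q) (full_transf n). e ` (P \<times> Q) \<subseteq> rank_class r n"
      using band_of_rectangular_group_mon[OF assms(3,6) _ n] \<phi> assms(8) by blast
    have "band_degree r p q \<le> d"
      unfolding band d using e by (intro Inf_lower) blast
    then show "(INF r\<in>{r. enat r \<ge> transf_degree G}. band_degree r p q) \<le> d"
      using r by (intro INF_lower2[of r]) auto
  qed
qed

end
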